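(* Let $1\le m<n$ be integers, let $\varphi$ be a finite measure on the unit circle $\mathbb{T}$ such that $D_k[\varphi]\ne0$ for $1\le k\le n-m$, let $A=(a_{jk})_{j,k=1}^m$ be an $m\times m$ matrix, and let $x_1,\dots,x_m$ and $y_1,\dots,y_m$ be variables. Define the $n\times n$ determinant $$D_n^F[\varphi;x_1,\dots,x_m;y_1,\dots,y_m;A]=\det\begin{pmatrix}\varphi_0&\varphi_{-1}&\cdots&\varphi_{-n+m+1}&1&\cdots&1\\ \varphi_1&\varphi_0&\cdots&\varphi_{-n+m+2}&x_1&\cdots&x_m\\ \vdots&\vdots&\ddots&\vdots&\vdots&\ddots&\vdots\\ \varphi_{n-m-1}&\varphi_{n-m-2}&\cdots&\varphi_0&x_1^{n-m-1}&\cdots&x_m^{n-m-1}\\ 1&y_1&\cdots&y_1^{n-m-1}&a_{11}&\cdots&a_{1m}\\ \vdots&\vdots&\ddots&\vdots&\vdots&\ddots&\vdots\\ 1&y_m&\cdots&y_m^{n-m-1}&a_{m1}&\cdots&a_{mm}\end{pmatrix}.$$ Then $$D_n^F[\varphi;x_1,\dots,x_m;y_1,\dots,y_m;A]=D_{n-m}[\varphi]\,\det\left[A-\left(\mathscr{K}_{n-m-1}(x_k,y_j)\right)_{j,k=1}^m\right],$$ where $\mathscr{K}_n(x,y):=\sum_{j=0}^nQ_j(y)\widehat Q_j(x)$ is the reproducing kernel of the system of biorthogonal polynomials on the unit circle satisfying $\int_{\mathbb{T}}Q_j(\zeta)\widehat Q_k(\zeta^{-1})\,\mathrm{d}\varp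hi(\zeta)=\delta_{jk}$.
   Context: $\varphi_j=\int_{\mathbb{T}}\zeta^{-j}\,\mathrm{d}\varphi(\zeta)$ for $j\in\mathbb{Z}$, and $D_k[\varphi]=\det(\varphi_{i-j})_{0\le i,j\le k-1}$. The polynomials $Q_k(z)=\kappa_kz^k+\cdots$ and $\widehat Q_k(z)=\widehat\kappa_kz^k+\cdots$ have degree $k$ with $\kappa_k=\widehat\kappa_k$ and $\kappa_k^2=D_k[\varphi]/D_{k+1}[\varphi]$ (with $D_0[\varphi]=1$). *)

theory Defs
  imports
    "HOL-Analysis.Bochner_Integration"
    "HOL-Computational_Algebra.Polynomial"
    "Jordan_Normal_Form.Determinant"
begin

text \<open>
  A finite, possibly complex measure \<open>\<phi>\<close> on the unit circle is given as
  \<open>d\<phi> = w d\<mu>\<close> with \<open>\<mu>\<close> a finite positive measure and \<open>w\<close> a \<open>\<mu>\<close>-integrable complex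
  density. By the polar decomposition with respect to the total variation, every complex
  measure has this form; \<open>w = (\<lambda>_. 1)\<close> gives the positive finite measures.
\<close>

definition unit_circle_measure :: "complex measure \<Rightarrow> (complex \<Rightarrow> complex) \<Rightarrow> bool" where
  "unit_circle_measure \<mu> w \<longleftrightarrow>
     finite_measure \<mu> \<and>
     sets \<mu> = sets (restrict_space borel (sphere 0 1)) \<and>
     integrable \<mu> w"

definition circle_integral ::
    "complex measure \<Rightarrow> (complex \<Rightarrow> complex) \<Rightarrow> (complex \<Rightarrow> complex) \<Rightarrow> complex" where
  "circle_integral \<mu> w f = (LINT \<zeta>|\<mu>. f \<zeta> * w \<zeta>)"

definition moment :: "complex measure \<Rightarrow> (complex \<Rightarrow> complex) \<Rightarrow> int \<Rightarrow> complex" where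
  "moment \<mu> w j = circle_integral \<mu> w (\<lambda>\<zeta>. \<zeta> powi (- j))"

definition toeplitz_mat :: "complex measure \<Rightarrow> (complex \<Rightarrow> complex) \<Rightarrow> nat \<Rightarrow> complex mat" where
  "toeplitz_mat \<mu> w k = mat k k (\<lambda>(i, j). moment \<mu> w (int i - int j))"

text \<open>The determinant of the empty matrix is 1, so \<open>toeplitz_det \<mu> w 0 = 1\<close>.\<close>

definition toeplitz_det :: "complex measure \<Rightarrow> (complex \<Rightarrow> complex) \<Rightarrow> nat \<Rightarrow> complex" where
  "toeplitz_det \<mu> w k = det (toeplitz_mat \<mu> w k)"

text \<open>
  The framing variables \<open>x\<^sub>1, \<dots>, x\<^sub>m\<close> and \<open>y\<^sub>1, \<dots>, y\<^sub>m\<close> are indexed from 0 here: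
  \<open>x k\<close> and \<open>y k\<close> with \<open>k < m\<close>.
\<close>

definition framed_toeplitz_det ::
    "complex measure \<Rightarrow> (complex \<Rightarrow> complex) \<Rightarrow> nat \<Rightarrow> nat \<Rightarrow>
     (nat \<Rightarrow> complex) \<Rightarrow> (nat \<Rightarrow> complex) \<Rightarrow> complex mat \<Rightarrow> complex" where
  "framed_toeplitz_det \<mu> w n m x y A =
     det (four_block_mat
            (toeplitz_mat \<mu> w (n - m))           (mat (n - m) m (\<lambda>(i, k). x k ^ i))
            (mat m (n - m) (\<lambda>(j, i). y j ^ i))    A)"

text \<open>
  The polynomials are required only up to degree \<open>N - 1\<close>, which is as far as nonvanishing of
  the Toeplitz determinants of sizes \<open>1, \<dots>, N\<close> guarantees their existence.
\<close>

definition biorthogonal_system ::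
    "complex measure \<Rightarrow> (complex \<Rightarrow> complex) \<Rightarrow> nat \<Rightarrow>
     (nat \<Rightarrow> complex poly) \<Rightarrow> (nat \<Rightarrow> complex poly) \<Rightarrow> bool" where
  "biorthogonal_system \<mu> w N Q Qh \<longleftrightarrow>
     (\<forall>k<N. degree (Q k) = k \<and> degree (Qh k) = k \<and>
            lead_coeff (Q k) = lead_coeff (Qh k) \<and>
            (lead_coeff (Q k))\<^sup>2 = toeplitz_det \<mu> w k / toeplitz_det \<mu> w (Suc k)) \<and>
     (\<forall>j<N. \<forall>k<N.
        circle_integral \<mu> w (\<lambda>\<zeta>. poly (Q j) \<zeta> * poly (Qh k) (inverse \<zeta>)) =
          (if j = k then 1 else 0))"

definition reproducing_kernel ::
    "(nat \<Rightarrow> complex poly) \<Rightarrow> (nat \<Rightarrow> complex poly) \<Rightarrow> nat \<Rightarrow> complex \<Rightarrow> complex \<Rightarrow> complex" where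
  "reproducing_kernel Q Qh n x y = (\<Sum>j=0..n. poly (Q j) y * poly (Qh j) x)"

end

theory Submission
  imports Defs
begin

text \<open>
  Let \<open>P\<close> and \<open>H\<close> hold the coefficients of the \<open>Q\<^sub>l\<close> (as columns) and of the \<open>Qh\<^sub>l\<close> (as rows).
  Biorthogonality says \<open>H T P = 1\<close> for the Toeplitz matrix \<open>T\<close>, so \<open>P H\<close> is its inverse. In the
  Schur complement \<open>A - C T\<^sup>-\<^sup>1 B\<close> of \<open>T\<close> the bordering blocks \<open>C\<close> and \<open>B\<close> turn the coefficients
  into the values \<open>Q\<^sub>l(y\<^sub>j)\<close> and \<open>Qh\<^sub>l(x\<^sub>k)\<close>, so that \<open>C P H B\<close> is the kernel matrix.
\<close>

text \<open>Padding with zero coefficients up to a common length \<open>N\<close> lets polynomials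
  of different degrees share one coefficient matrix.\<close>

lemma poly_eq_sum_lessThan:
  fixes p :: "'a :: comm_semiring_1 poly"
  assumes "degree p < N"
  shows "poly p z = (\<Sum>i<N. coeff p i * z ^ i)"
  unfolding poly_altdef using assms
  by (intro sum.mono_neutral_left) (auto simp: coeff_eq_0)

text \<open>Block elimination: the matrix is a unit lower block triangular factor, with
  \<open>C * R\<close> below the diagonal, times an upper block triangular factor with diagonal
  blocks \<open>T\<close> and \<open>A - C * R * B\<close>. Taking a left inverse \<open>R\<close>
  as data avoids division, so any integral domain will do.\<close>

lemma det_four_block_mat_Schur:
  fixes T :: "'a :: idom mat"
  assumes T: "T \<in> carrier_mat N N" and B: "B \<in> carrier_mat N m"
    and C: "C \<in> carrier_mat m N" and A: "A \<in> carrier_mat m m"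
    and R: "R \<in> carrier_mat N N" and RT: "R * T = 1\<^sub>m N"
  shows "det (four_block_mat T B C A) = det T * det (A - C * R * B)"
proof -
  have CR: "C * R \<in> carrier_mat m N" using C R by simp
  \<comment> \<open>This is the lower left block of the product of the two factors; it collapses to
    \<open>C\<close> because \<open>R * T\<close> is the identity.\<close>
  have "C * R * T = C * (R * T)" using C R T by (rule assoc_mult_mat)
  then have CRT: "C * R * T = C" using RT C by simp
  define D where "D = C * R * B"
  have D: "D \<in> carrier_mat m m" unfolding D_def by (rule mult_carrier_mat[OF CR B])
  then have AD: "A - D \<in> carrier_mat m m" by (rule minus_carrier_mat)
  have "four_block_mat (1\<^sub>m N) (0\<^sub>m N m) (C * R) (1\<^sub>m m) * four_block_mat T B (0\<^sub>m m N) (A - D) =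
      four_block_mat (1\<^sub>m N * T + 0\<^sub>m N m * 0\<^sub>m m N) (1\<^sub>m N * B + 0\<^sub>m N m * (A - D))
        (C * R * T + 1\<^sub>m m * 0\<^sub>m m N) (C * R * B + 1\<^sub>m m * (A - D))"
    by (rule mult_four_block_mat) (use T B CR AD in auto)
  also have "\<dots> = four_block_mat T B C A"
  proof (rule cong_four_block_mat)
    show "1\<^sub>m N * B + 0\<^sub>m N m * (A - D) = B"
      using B left_mult_zero_mat[OF AD] by simp
    have "D + (A - D) = A" using A D by (intro eq_matI) auto
    then show "C * R * B + 1\<^sub>m m * (A - D) = A"
      using left_mult_one_mat[OF AD] by (simp flip: D_def)
    show "C * R * T + 1\<^sub>m m * 0\<^sub>m m N = C" using C by (simp add: CRT del: assoc_mult_mat)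
  qed (use T in simp)
  finally have "four_block_mat T B C A =
      four_block_mat (1\<^sub>m N) (0\<^sub>m N m) (C * R) (1\<^sub>m m) * four_block_mat T B (0\<^sub>m m N) (A - D)"
    by (rule sym)
  also have "det \<dots> = det (four_block_mat (1\<^sub>m N) (0\<^sub>m N m) (C * R) (1\<^sub>m m)) *
      det (four_block_mat T B (0\<^sub>m m N) (A - D))"
    by (rule det_mult[where n = "N + m"]) (use T AD in auto)
  also have "det (four_block_mat (1\<^sub>m N) (0\<^sub>m N m) (C * R) (1\<^sub>m m)) = det (1\<^sub>m N) * det (1\<^sub>m m)"
    by (rule det_four_block_mat_upper_right_zero) (use CR in auto)
  also have "det (four_block_mat T B (0\<^sub>m m N) (A - D)) = det T * det (A - D)"
    by (rule det_four_block_mat_lower_left_zero) (use T B AD in auto)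
  finally show ?thesis by (simp add: D_def)
qed

lemma space_unit_circle_measure:
  assumes "unit_circle_measure \<mu> w"
  shows "space \<mu> = sphere 0 1"
  using assms sets_eq_imp_space_eq[of \<mu> "restrict_space borel (sphere 0 1)"]
  by (auto simp: unit_circle_measure_def space_restrict_space)

text \<open>Monomials have modulus 1 on the circle, so the density \<open>w\<close> itself is an
  integrable bound.\<close>

lemma integrable_circle_monomial:
  assumes \<mu>: "unit_circle_measure \<mu> w"
  shows "integrable \<mu> (\<lambda>\<zeta>. \<zeta> ^ k * inverse \<zeta> ^ i * w \<zeta>)"
proof (rule Bochner_Integration.integrable_bound)
  show w: "integrable \<mu> w" using \<mu> by (simp add: unit_circle_measure_def)
  have "(\<lambda>\<zeta>::complex. \<zeta>) \<in> borel_measurable (restrict_space borel (sphere 0 1))"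
    by (intro measurable_restrict_space1) simp
  then have [measurable]: "(\<lambda>\<zeta>. \<zeta>) \<in> borel_measurable \<mu>"
    using \<mu> by (simp add: unit_circle_measure_def cong: measurable_cong_sets)
  show "(\<lambda>\<zeta>. \<zeta> ^ k * inverse \<zeta> ^ i * w \<zeta>) \<in> borel_measurable \<mu>"
    using w by measurable
  show "AE \<zeta> in \<mu>. norm (\<zeta> ^ k * inverse \<zeta> ^ i * w \<zeta>) \<le> norm (w \<zeta>)"
    by (rule AE_I2) (simp add: space_unit_circle_measure[OF \<mu>] norm_mult norm_power norm_inverse)
qed

text \<open>Since \<zeta> is nonzero on the circle, the integer power splits into the natural powers
  that occur in the expansion of a product of two polynomials.\<close>

lemma moment_diff:
  assumes \<mu>: "unit_circle_measure \<mu> w"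
  shows "moment \<mu> w (int i - int k) = (LINT \<zeta>|\<mu>. \<zeta> ^ k * inverse \<zeta> ^ i * w \<zeta>)"
  unfolding moment_def circle_integral_def
proof (rule Bochner_Integration.integral_cong)
  fix \<zeta> assume "\<zeta> \<in> space \<mu>"
  then have "\<zeta> \<noteq> 0" using space_unit_circle_measure[OF \<mu>] by auto
  then show "\<zeta> powi (- (int i - int k)) * w \<zeta> = \<zeta> ^ k * inverse \<zeta> ^ i * w \<zeta>"
    by (simp add: power_int_diff field_simps)
qed simp

text \<open>Expanding both polynomials turns the pairing into a bilinear form in their coefficients
  whose Gram matrix is the Toeplitz matrix.\<close>

lemma circle_integral_poly_product:
  assumes \<mu>: "unit_circle_measure \<mu> w" and "degree p < N" "degree q < N"
  shows "circle_integral \<mu> w (\<lambda>\<zeta>. poly p \<zeta> * poly q (inverse \<zeta>)) =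
    (\<Sum>k<N. \<Sum>i<N. coeff p k * coeff q i * moment \<mu> w (int i - int k))"
proof -
  have "circle_integral \<mu> w (\<lambda>\<zeta>. poly p \<zeta> * poly q (inverse \<zeta>)) =
    (LINT \<zeta>|\<mu>. (\<Sum>k<N. \<Sum>i<N. coeff p k * coeff q i * (\<zeta> ^ k * inverse \<zeta> ^ i * w \<zeta>)))"
    unfolding circle_integral_def poly_eq_sum_lessThan[OF assms(2)] poly_eq_sum_lessThan[OF assms(3)]
    unfolding sum_product unfolding sum_distrib_right by (simp only: mult_ac)
  also have "\<dots> = (\<Sum>k<N. \<Sum>i<N. coeff p k * coeff q i * moment \<mu> w (int i - int k))"
    by (simp add: Bochner_Integration.integral_sum integrable_circle_monomial[OF \<mu>] moment_diff[OF \<mu>])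
  finally show ?thesis .
qed

lemma biorthogonal_system_toeplitz_inverse:
  assumes \<mu>: "unit_circle_measure \<mu> w" and Q: "biorthogonal_system \<mu> w N Q Qh"
  shows "mat N N (\<lambda>(k, l). coeff (Q l) k) * mat N N (\<lambda>(l, i). coeff (Qh l) i) * toeplitz_mat \<mu> w N
         = 1\<^sub>m N"
proof -
  define P where "P = mat N N (\<lambda>(k, l). coeff (Q l) k)"
  define H where "H = mat N N (\<lambda>(l, i). coeff (Qh l) i)"
  define T where "T = toeplitz_mat \<mu> w N"
  have carr: "P \<in> carrier_mat N N" "H \<in> carrier_mat N N" "T \<in> carrier_mat N N"
    by (auto simp: P_def H_def T_def toeplitz_mat_def)
  have "H * T * P = 1\<^sub>m N"
  proof (rule eq_matI)
    fix l j assume "l < dim_row (1\<^sub>m N :: complex mat)" "j < dim_col (1\<^sub>m N :: complex mat)"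
    then have lj: "l < N" "j < N" by auto
    \<comment> \<open>Row \<open>l\<close> of \<open>H\<close> carries \<open>Qh l\<close> and
      column \<open>j\<close> of \<open>P\<close> carries \<open>Q j\<close>, so this entry is the
      pairing of \<open>Q j\<close> with \<open>Qh l\<close>.\<close>
    have "(H * T * P) $$ (l, j) =
        (\<Sum>k<N. \<Sum>i<N. coeff (Q j) k * coeff (Qh l) i * moment \<mu> w (int i - int k))"
      using lj by (simp add: P_def H_def T_def toeplitz_mat_def scalar_prod_def
          atLeast0LessThan sum_distrib_left sum_distrib_right mult_ac)
    also have "\<dots> = circle_integral \<mu> w (\<lambda>\<zeta>. poly (Q j) \<zeta> * poly (Qh l) (inverse \<zeta>))"
      using Q lj by (intro circle_integral_poly_product[OF \<mu>, symmetric])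
        (auto simp: biorthogonal_system_def)
    also have "\<dots> = 1\<^sub>m N $$ (l, j)"
      using Q lj by (auto simp: biorthogonal_system_def)
    finally show "(H * T * P) $$ (l, j) = 1\<^sub>m N $$ (l, j)" .
  qed (use carr in auto)
  \<comment> \<open>For square matrices over a field a one-sided inverse is two-sided, so
    \<open>P\<close> may move from the right of \<open>H * T\<close> to its left.\<close>
  then have "P * (H * T) = 1\<^sub>m N"
    using carr mat_mult_left_right_inverse[of "H * T" N P] by auto
  moreover have "P * H * T = P * (H * T)"
    using carr by (intro assoc_mult_mat)
  ultimately show ?thesis
    by (simp only: P_def H_def T_def)
qed

theorem proposition1p16:
  fixes m n :: nat
    and \<mu> :: "complex measure" and w :: "complex \<Rightarrow> complex"
    and A :: "complex mat" and x y :: "nat \<Rightarrow> complex"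
    and Q Qh :: "nat \<Rightarrow> complex poly"
  assumes "1 \<le> m" and "m < n"
    and "unit_circle_measure \<mu> w"
    and "\<And>k. 1 \<le> k \<Longrightarrow> k \<le> n - m \<Longrightarrow> toeplitz_det \<mu> w k \<noteq> 0"
    and "A \<in> carrier_mat m m"
    and "biorthogonal_system \<mu> w (n - m) Q Qh"
  shows "framed_toeplitz_det \<mu> w n m x y A =
         toeplitz_det \<mu> w (n - m) *
         det (A - mat m m (\<lambda>(j, k). reproducing_kernel Q Qh (n - m - 1) (x k) (y j)))"
proof -
  define N where "N = n - m"
  define P where "P = mat N N (\<lambda>(k, l). coeff (Q l) k)"
  define H where "H = mat N N (\<lambda>(l, i). coeff (Qh l) i)"
  define B where "B = mat N m (\<lambda>(i, k). x k ^ i)"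
  define C where "C = mat m N (\<lambda>(j, i). y j ^ i)"
  have carr: "P \<in> carrier_mat N N" "H \<in> carrier_mat N N"
      "B \<in> carrier_mat N m" "C \<in> carrier_mat m N"
    by (auto simp: P_def H_def B_def C_def)
  have deg: "degree (Q l) < N" "degree (Qh l) < N" if "l < N" for l
    using assms(6) that by (auto simp: biorthogonal_system_def N_def)
  \<comment> \<open>The rows of \<open>C\<close> and the columns of \<open>B\<close> list powers of
    the framing variables, so multiplying by a coefficient matrix evaluates the polynomials
    there.\<close>
  have CP: "C * P = mat m N (\<lambda>(j, l). poly (Q l) (y j))"
    by (rule eq_matI)
       (simp_all add: C_def P_def scalar_prod_def atLeast0LessThan poly_eq_sum_lessThan[where N = N] deg mult_ac)
  have HB: "H * B = mat N m (\<lambda>(l, k). poly (Qh l) (x k))"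
    by (rule eq_matI)
       (simp_all add: H_def B_def scalar_prod_def atLeast0LessThan poly_eq_sum_lessThan[where N = N] deg)
  \<comment> \<open>From \<open>m < n\<close> follows \<open>N > 0\<close>, so the subtraction does
    not truncate and the kernel has exactly \<open>N\<close> terms, matching the inner dimension of
    the product.\<close>
  have "{0..N - 1} = {0..<N}" using assms(2) by (auto simp: N_def)
  then have K: "(C * P) * (H * B) = mat m m (\<lambda>(j, k). reproducing_kernel Q Qh (N - 1) (x k) (y j))"
    unfolding CP HB by (intro eq_matI) (simp_all add: scalar_prod_def reproducing_kernel_def)
  have "C * (P * H) * B = (C * P) * (H * B)"
    using carr assoc_mult_mat[of C m N P N "H * B" m] assoc_mult_mat[of P N N H N B m]
      assoc_mult_mat[of C m N "P * H" N B m] by simp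
  \<comment> \<open>Schur complement with \<open>R\<close> taken to be \<open>P * H\<close>.\<close>
  moreover have "det (four_block_mat (toeplitz_mat \<mu> w N) B C A) =
      det (toeplitz_mat \<mu> w N) * det (A - C * (P * H) * B)"
    using biorthogonal_system_toeplitz_inverse[OF assms(3,6)] carr assms(5)
    by (intro det_four_block_mat_Schur[where N = N and m = m])
       (auto simp: toeplitz_mat_def N_def P_def H_def)
  ultimately show ?thesis
    by (simp only: K framed_toeplitz_det_def toeplitz_det_def flip: N_def B_def C_def)
qed

end
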